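(* Let $(\mathscr{G},\mathscr{H},\sigma)$ be a matched pair of dynamical groups over $\Lambda$, with $\sigma(\lambda,a,x)=(a\rightharpoonup_\lambda x,\ a\leftharpoonup_\lambda x)$. Let $Q(\mathscr{G})=\Lambda\times G$ (source $\alpha(\lambda,a)=\lambda$, target $\beta(\lambda,a)=\phi_G(\lambda,a)$) and $Q(\mathscr{H})=\Lambda\times H$ (source $s(\lambda,x)=\lambda$, target $t(\lambda,x)=\phi_H(\lambda,x)$) be the associated groupoids over $\Lambda$. Then $(Q(\mathscr{G}),Q(\mathscr{H}),\hat\sigma)$ is a matched pair of groupoids, where $\hat\sigma:Q(\mathscr{G})_\beta\times_sQ(\mathscr{H})\to Q(\mathscr{H})_t\times_\alpha Q(\mathscr{G})$ is given by $$\hat\sigma\big((\lambda,a),(\lambda',x)\big)=\big((\lambda,a\rightharpoonup_\lambda x),\ (\phi_H(\lambda,a\rightharpoonup_\lambda x),a\leftharpoonup_\lambda x)\big)$$ for all $(\lambda,a)\in Q(\mathscr{G})$, $(\lambda',x)\in Q(\mathscr{H})$ with $\lambda'=\phi_G(\lambda,a)$.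
   Context: Fix a non-empty set $\Lambda$. A dynamical set is a triple $\mathscr{X}=(X,\Lambda,\phi_X)$ with $X$ a set and $\phi_X:\Lambda\times X\to\Lambda$ a map. A morphism $\mathscr{X}\to\mathscr{Y}$ is a map $f:\Lambda\times X\to Y$ with $\phi_Y(\lambda,f(\lambda,x))=\phi_X(\lambda,x)$. The tensor product is $\mathscr{X}\otimes\mathscr{Y}=(X\times Y,\Lambda,\phi_{X\times Y})$, $\phi_{X\times Y}(\lambda,x,y)=\phi_Y(\phi_X(\lambda,x),y)$. Dynamical group: a dynamical set $\mathscr{G}=(G,\Lambda,\phi_G)$ with maps $\circ_\lambda:G\times G\to G$ ($\lambda\in\Lambda$) such that $\phi_G(\lambda,a\circ_\lambda b)=\phi_G(\phi_G(\lambda,a),b)$ and $a\circ_\lambda(b\circ_{\phi_G(\lambda,a)}c)=(a\circ_\lambda b)\circ_\lambda c$; an element $e_G\in G$ with $a\circ_\lambda e_G=e_G\circ_\lambda a=a$ and $\phi_G(\lambda,e_G)=\lambda$; and for all $\lambda,a$ an element $\bar a^\lambda\in G$ with $a\circ_\lambda\bar a^\lambda=\bar a^\lambda\circ_{\phi_G(\lambda,a)}a=e_G$. The associated groupoid $Q(\mathscr{G})=\Lambda\times G$ over $\Lambda$ has multiplication $(\lambda,a)\star(\phi_G(\lambda,a),b)=(\lambda,a\circ_\lambda b)$, identities $(\lambda,e_G)$, and inverse $(\phi_G(\lambda,a),\bar a^\lambda)$ of $(\lambda,a)$. Matched pair of dynamical groups $(\mathscr{G},\mathscr{H},\sigma)$: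 dynamical groups $(\mathscr{G},\circ)$, $(\mathscr{H},\cdot)$ and a map $\sigma:\Lambda\times G\times H\to H\times G$, written $\sigma(\lambda,a,x)=(a\rightharpoonup_\lambda x,\ a\leftharpoonup_\lambda x)$ (the subscript is the first argument of $\sigma$), which is a morphism $\mathscr{G}\otimes\mathscr{H}\to\mathscr{H}\otimes\mathscr{G}$, i.e. $\phi_G(\phi_H(\lambda,a\rightharpoonup_\lambda x),a\leftharpoonup_\lambda x)=\phi_H(\phi_G(\lambda,a),x)$, such that for all $\lambda\in\Lambda$, $a,b\in G$, $x,y\in H$: (1) $e_G\rightharpoonup_\lambda x=x$; (2) $(a\circ_\lambda b)\rightharpoonup_\lambda x=a\rightharpoonup_\lambda(b\rightharpoonup_{\phi_G(\lambda,a)}x)$; (3) $a\rightharpoonup_\lambda(x\cdot_{\phi_G(\lambda,a)}y)=(a\rightharpoonup_\lambda x)\cdot_\lambda\big((a\leftharpoonup_\lambda x)\rightharpoonup_{\phi_H(\lambda,a\rightharpoonup_\lambda x)}y\big)$; (4) $a\leftharpoonup_\lambda e_H=a$; (5) $a\leftharpoonup_\lambda(x\cdot_{\phi_G(\lambda,a)}y)=(a\leftharpoonup_\lambda x)\leftharpoonup_{\phi_H(\lambda,a\rightharpoonup_\lambda x)}y$; (6) $(a\circ_\lambda b)\leftharpoonup_\lambda x=\big(a\leftharpoonup_\lambda(b\rightharpoonup_{\phi_G(\lambda,a)}x)\big)\circ_{\phi_H(\lambda,(a\circ_\lambda b)\rightharpoonup_\lambda x)}(b\leftharpoonup_{\phi_G(\lambda,a)}x)$.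 Matched pair of groupoids $(\mathbb{G},\mathbb{H},\sigma)$: groupoids $\mathbb{G}$ (source $\alpha$, target $\beta$) and $\mathbb{H}$ (source $s$, target $t$) over the same base (products $\gamma_1\star\gamma_2$ defined when the target of $\gamma_1$ is the source of $\gamma_2$, identities $\iota_m$) and a map $\sigma:\mathbb{G}_\beta\times_s\mathbb{H}\to\mathbb{H}_t\times_\alpha\mathbb{G}$, $(\gamma,\delta)\mapsto(\gamma\rightharpoonup\delta,\gamma\leftharpoonup\delta)$, where $\mathbb{G}_\beta\times_s\mathbb{H}=\{(\gamma,\delta):\beta(\gamma)=s(\delta)\}$, that is a homomorphism of quivers ($s(\gamma\rightharpoonup\delta)=\alpha(\gamma)$, $\beta(\gamma\leftharpoonup\delta)=t(\delta)$), such that, whenever defined: $\iota_{s(\delta)}\rightharpoonup\delta=\delta$; $\gamma_1\rightharpoonup(\gamma_2\rightharpoonup\delta)=(\gamma_1\star\gamma_2)\rightharpoonup\delta$; $(\gamma_1\star\gamma_2)\leftharpoonup\delta=(\gamma_1\leftharpoonup(\gamma_2\rightharpoonup\delta))\star(\gamma_2\leftharpoonup\delta)$; $\gamma\leftharpoonup\iota_{\beta(\gamma)}=\gamma$; $(\gamma\leftharpoonup\delta_1)\leftharpoonup\delta_2=\gamma\leftharpoonup(\delta_1\star\delta_2)$; $\gamma\rightharpoonup(\delta_1\star\delta_2)=(\gamma\rightharpoonup\delta_1)\star((\gamma\leftharpoonup\delta_1)\rightharpoonup\delta_2)$. *)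

theory Defs
  imports Main "HOL-Library.FuncSet"
begin

section \<open>Dynamical sets\<close>

record ('l, 'x) dyn_set =
  carr :: "'x set"
  phi :: "'l \<Rightarrow> 'x \<Rightarrow> 'l"

locale dynamical_set =
  fixes \<Lambda> :: "'l set" and X :: "('l, 'x, 'm) dyn_set_scheme"
  assumes base_nonempty: "\<Lambda> \<noteq> {}"
    and phi_closed: "\<And>l x. \<lbrakk>l \<in> \<Lambda>; x \<in> carr X\<rbrakk> \<Longrightarrow> phi X l x \<in> \<Lambda>"

definition dyn_morphism ::
  "'l set \<Rightarrow> ('l, 'x, 'm) dyn_set_scheme \<Rightarrow> ('l, 'y, 'n) dyn_set_scheme \<Rightarrow> ('l \<Rightarrow> 'x \<Rightarrow> 'y) \<Rightarrow> bool"
  where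
  "dyn_morphism \<Lambda> X Y f \<longleftrightarrow>
     (\<forall>l\<in>\<Lambda>. \<forall>x\<in>carr X. f l x \<in> carr Y \<and> phi Y l (f l x) = phi X l x)"

definition dyn_tensor ::
  "('l, 'x, 'm) dyn_set_scheme \<Rightarrow> ('l, 'y, 'n) dyn_set_scheme \<Rightarrow> ('l, 'x \<times> 'y) dyn_set"
  where
  "dyn_tensor X Y =
     \<lparr>carr = carr X \<times> carr Y, phi = (\<lambda>l (x, y). phi Y (phi X l x) y)\<rparr>"


section \<open>Dynamical groups\<close>

text \<open>\<open>dmul G l a b\<close> stands for $a \circ_l b$.\<close>

record ('l, 'x) dyn_group = "('l, 'x) dyn_set" +
  dmul :: "'l \<Rightarrow> 'x \<Rightarrow> 'x \<Rightarrow> 'x"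
  dunit :: 'x

locale dynamical_group = dynamical_set \<Lambda> G
  for \<Lambda> :: "'l set" and G :: "('l, 'x, 'm) dyn_group_scheme" +
  assumes dmul_closed:
      "\<And>l a b. \<lbrakk>l \<in> \<Lambda>; a \<in> carr G; b \<in> carr G\<rbrakk> \<Longrightarrow> dmul G l a b \<in> carr G"
    and phi_dmul:
      "\<And>l a b. \<lbrakk>l \<in> \<Lambda>; a \<in> carr G; b \<in> carr G\<rbrakk> \<Longrightarrow>
        phi G l (dmul G l a b) = phi G (phi G l a) b"
    and dmul_assoc:
      "\<And>l a b c. \<lbrakk>l \<in> \<Lambda>; a \<in> carr G; b \<in> carr G; c \<in> carr G\<rbrakk> \<Longrightarrow>
        dmul G l a (dmul G (phi G l a) b c) = dmul G l (dmul G l a b) c"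
    and dunit_closed: "dunit G \<in> carr G"
    and dmul_dunit_right:
      "\<And>l a. \<lbrakk>l \<in> \<Lambda>; a \<in> carr G\<rbrakk> \<Longrightarrow> dmul G l a (dunit G) = a"
    and dmul_dunit_left:
      "\<And>l a. \<lbrakk>l \<in> \<Lambda>; a \<in> carr G\<rbrakk> \<Longrightarrow> dmul G l (dunit G) a = a"
    and phi_dunit: "\<And>l. l \<in> \<Lambda> \<Longrightarrow> phi G l (dunit G) = l"
    and dinv_exists:
      "\<And>l a. \<lbrakk>l \<in> \<Lambda>; a \<in> carr G\<rbrakk> \<Longrightarrow>
        \<exists>b\<in>carr G. dmul G l a b = dunit G \<and> dmul G (phi G l a) b a = dunit G"

text \<open>The inverse $\bar{a}^l$; in a dynamical group it is unique, because any
  such \<open>b\<close> satisfies \<open>phi G (phi G l a) b = l\<close>.\<close>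

definition dinv :: "('l, 'x, 'm) dyn_group_scheme \<Rightarrow> 'l \<Rightarrow> 'x \<Rightarrow> 'x" where
  "dinv G l a =
     (THE b. b \<in> carr G \<and> dmul G l a b = dunit G \<and> dmul G (phi G l a) b a = dunit G)"


section \<open>Matched pairs of dynamical groups\<close>

text \<open>The two components of $\sigma(l,a,x) = (a \rightharpoonup_l x,\, a \leftharpoonup_l x)$.\<close>

definition lact :: "('l \<Rightarrow> 'g \<times> 'h \<Rightarrow> 'h \<times> 'g) \<Rightarrow> 'l \<Rightarrow> 'g \<Rightarrow> 'h \<Rightarrow> 'h" where
  "lact \<sigma> l a x = fst (\<sigma> l (a, x))"

definition ract :: "('l \<Rightarrow> 'g \<times> 'h \<Rightarrow> 'h \<times> 'g) \<Rightarrow> 'l \<Rightarrow> 'g \<Rightarrow> 'h \<Rightarrow> 'g" where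
  "ract \<sigma> l a x = snd (\<sigma> l (a, x))"

locale matched_pair_dynamical_groups =
  G: dynamical_group \<Lambda> G + H: dynamical_group \<Lambda> H
  for \<Lambda> :: "'l set"
    and G :: "('l, 'g, 'm) dyn_group_scheme"
    and H :: "('l, 'h, 'n) dyn_group_scheme" +
  fixes \<sigma> :: "'l \<Rightarrow> 'g \<times> 'h \<Rightarrow> 'h \<times> 'g"
  assumes sigma_morphism: "dyn_morphism \<Lambda> (dyn_tensor G H) (dyn_tensor H G) \<sigma>"
    and lact_dunit:
      "\<And>l x. \<lbrakk>l \<in> \<Lambda>; x \<in> carr H\<rbrakk> \<Longrightarrow> lact \<sigma> l (dunit G) x = x"
    and lact_dmul_left:
      "\<And>l a b x. \<lbrakk>l \<in> \<Lambda>; a \<in> carr G; b \<in> carr G; x \<in> carr H\<rbrakk> \<Longrightarrow>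
        lact \<sigma> l (dmul G l a b) x = lact \<sigma> l a (lact \<sigma> (phi G l a) b x)"
    and lact_dmul_right:
      "\<And>l a x y. \<lbrakk>l \<in> \<Lambda>; a \<in> carr G; x \<in> carr H; y \<in> carr H\<rbrakk> \<Longrightarrow>
        lact \<sigma> l a (dmul H (phi G l a) x y) =
          dmul H l (lact \<sigma> l a x)
            (lact \<sigma> (phi H l (lact \<sigma> l a x)) (ract \<sigma> l a x) y)"
    and ract_dunit:
      "\<And>l a. \<lbrakk>l \<in> \<Lambda>; a \<in> carr G\<rbrakk> \<Longrightarrow> ract \<sigma> l a (dunit H) = a"
    and ract_dmul_right:
      "\<And>l a x y. \<lbrakk>l \<in> \<Lambda>; a \<in> carr G; x \<in> carr H; y \<in> carr H\<rbrakk> \<Longrightarrow>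
        ract \<sigma> l a (dmul H (phi G l a) x y) =
          ract \<sigma> (phi H l (lact \<sigma> l a x)) (ract \<sigma> l a x) y"
    and ract_dmul_left:
      "\<And>l a b x. \<lbrakk>l \<in> \<Lambda>; a \<in> carr G; b \<in> carr G; x \<in> carr H\<rbrakk> \<Longrightarrow>
        ract \<sigma> l (dmul G l a b) x =
          dmul G (phi H l (lact \<sigma> l (dmul G l a b) x))
            (ract \<sigma> l a (lact \<sigma> (phi G l a) b x))
            (ract \<sigma> (phi G l a) b x)"


section \<open>Groupoids\<close>

text \<open>Composition is written in path order: \<open>gcomp Q g1 g2\<close> is meaningful only if
  \<open>tgt Q g1 = src Q g2\<close>, and nothing is assumed about it otherwise.\<close>

record ('m, 'a) groupoid_struct =
  objs :: "'m set"
  arrows :: "'a set"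
  src :: "'a \<Rightarrow> 'm"
  tgt :: "'a \<Rightarrow> 'm"
  gcomp :: "'a \<Rightarrow> 'a \<Rightarrow> 'a"
  ident :: "'m \<Rightarrow> 'a"
  inver :: "'a \<Rightarrow> 'a"

locale groupoid =
  fixes Q :: "('m, 'a) groupoid_struct"
  assumes src_closed: "\<And>g. g \<in> arrows Q \<Longrightarrow> src Q g \<in> objs Q"
    and tgt_closed: "\<And>g. g \<in> arrows Q \<Longrightarrow> tgt Q g \<in> objs Q"
    and comp_closed:
      "\<And>g1 g2. \<lbrakk>g1 \<in> arrows Q; g2 \<in> arrows Q; tgt Q g1 = src Q g2\<rbrakk> \<Longrightarrow>
        gcomp Q g1 g2 \<in> arrows Q"
    and src_comp:
      "\<And>g1 g2. \<lbrakk>g1 \<in> arrows Q; g2 \<in> arrows Q; tgt Q g1 = src Q g2\<rbrakk> \<Longrightarrow>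
        src Q (gcomp Q g1 g2) = src Q g1"
    and tgt_comp:
      "\<And>g1 g2. \<lbrakk>g1 \<in> arrows Q; g2 \<in> arrows Q; tgt Q g1 = src Q g2\<rbrakk> \<Longrightarrow>
        tgt Q (gcomp Q g1 g2) = tgt Q g2"
    and comp_assoc:
      "\<And>g1 g2 g3. \<lbrakk>g1 \<in> arrows Q; g2 \<in> arrows Q; g3 \<in> arrows Q;
          tgt Q g1 = src Q g2; tgt Q g2 = src Q g3\<rbrakk> \<Longrightarrow>
        gcomp Q (gcomp Q g1 g2) g3 = gcomp Q g1 (gcomp Q g2 g3)"
    and ident_closed: "\<And>m. m \<in> objs Q \<Longrightarrow> ident Q m \<in> arrows Q"
    and src_ident: "\<And>m. m \<in> objs Q \<Longrightarrow> src Q (ident Q m) = m"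
    and tgt_ident: "\<And>m. m \<in> objs Q \<Longrightarrow> tgt Q (ident Q m) = m"
    and comp_ident_left: "\<And>g. g \<in> arrows Q \<Longrightarrow> gcomp Q (ident Q (src Q g)) g = g"
    and comp_ident_right: "\<And>g. g \<in> arrows Q \<Longrightarrow> gcomp Q g (ident Q (tgt Q g)) = g"
    and inver_closed: "\<And>g. g \<in> arrows Q \<Longrightarrow> inver Q g \<in> arrows Q"
    and src_inver: "\<And>g. g \<in> arrows Q \<Longrightarrow> src Q (inver Q g) = tgt Q g"
    and tgt_inver: "\<And>g. g \<in> arrows Q \<Longrightarrow> tgt Q (inver Q g) = src Q g"
    and comp_inver_right:
      "\<And>g. g \<in> arrows Q \<Longrightarrow> gcomp Q g (inver Q g) = ident Q (src Q g)"
    and comp_inver_left: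
      "\<And>g. g \<in> arrows Q \<Longrightarrow> gcomp Q (inver Q g) g = ident Q (tgt Q g)"

definition dyn_groupoid ::
  "'l set \<Rightarrow> ('l, 'x, 'm) dyn_group_scheme \<Rightarrow> ('l, 'l \<times> 'x) groupoid_struct"
  where
  "dyn_groupoid \<Lambda> G =
     \<lparr>objs = \<Lambda>,
      arrows = \<Lambda> \<times> carr G,
      src = (\<lambda>(l, a). l),
      tgt = (\<lambda>(l, a). phi G l a),
      gcomp = (\<lambda>(l, a) (l', b). (l, dmul G l a b)),
      ident = (\<lambda>l. (l, dunit G)),
      inver = (\<lambda>(l, a). (phi G l a, dinv G l a))\<rparr>"


section \<open>Matched pairs of groupoids\<close>

definition fibre_product :: "'a set \<Rightarrow> ('a \<Rightarrow> 'm) \<Rightarrow> ('b \<Rightarrow> 'm) \<Rightarrow> 'b set \<Rightarrow> ('a \<times> 'b) set" where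
  "fibre_product A f g B = {(x, y). x \<in> A \<and> y \<in> B \<and> f x = g y}"

definition glact :: "('a \<times> 'b \<Rightarrow> 'b \<times> 'a) \<Rightarrow> 'a \<Rightarrow> 'b \<Rightarrow> 'b" where
  "glact \<tau> g d = fst (\<tau> (g, d))"

definition gract :: "('a \<times> 'b \<Rightarrow> 'b \<times> 'a) \<Rightarrow> 'a \<Rightarrow> 'b \<Rightarrow> 'a" where
  "gract \<tau> g d = snd (\<tau> (g, d))"

text \<open>Both actions are read only on pairs \<open>(g, d)\<close> with \<open>tgt G g = src H d\<close>;
  the hypotheses of each axiom say exactly that the expressions in it are defined.\<close>

locale matched_pair_groupoids =
  G: groupoid G + H: groupoid H
  for G :: "('m, 'a) groupoid_struct"
    and H :: "('m, 'b) groupoid_struct" +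
  fixes \<tau> :: "'a \<times> 'b \<Rightarrow> 'b \<times> 'a"
  assumes same_base: "objs G = objs H"
    and tau_maps:
      "\<tau> \<in> fibre_product (arrows G) (tgt G) (src H) (arrows H) \<rightarrow>
           fibre_product (arrows H) (tgt H) (src G) (arrows G)"
    and src_glact:
      "\<And>g d. \<lbrakk>g \<in> arrows G; d \<in> arrows H; tgt G g = src H d\<rbrakk> \<Longrightarrow>
        src H (glact \<tau> g d) = src G g"
    and tgt_gract:
      "\<And>g d. \<lbrakk>g \<in> arrows G; d \<in> arrows H; tgt G g = src H d\<rbrakk> \<Longrightarrow>
        tgt G (gract \<tau> g d) = tgt H d"
    and glact_ident:
      "\<And>d. d \<in> arrows H \<Longrightarrow> glact \<tau> (ident G (src H d)) d = d"
    and glact_comp_left: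
      "\<And>g1 g2 d. \<lbrakk>g1 \<in> arrows G; g2 \<in> arrows G; d \<in> arrows H;
          tgt G g1 = src G g2; tgt G g2 = src H d\<rbrakk> \<Longrightarrow>
        glact \<tau> g1 (glact \<tau> g2 d) = glact \<tau> (gcomp G g1 g2) d"
    and gract_comp_left:
      "\<And>g1 g2 d. \<lbrakk>g1 \<in> arrows G; g2 \<in> arrows G; d \<in> arrows H;
          tgt G g1 = src G g2; tgt G g2 = src H d\<rbrakk> \<Longrightarrow>
        gract \<tau> (gcomp G g1 g2) d =
          gcomp G (gract \<tau> g1 (glact \<tau> g2 d)) (gract \<tau> g2 d)"
    and gract_ident:
      "\<And>g. g \<in> arrows G \<Longrightarrow> gract \<tau> g (ident H (tgt G g)) = g"
    and gract_comp_right: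
      "\<And>g d1 d2. \<lbrakk>g \<in> arrows G; d1 \<in> arrows H; d2 \<in> arrows H;
          tgt G g = src H d1; tgt H d1 = src H d2\<rbrakk> \<Longrightarrow>
        gract \<tau> (gract \<tau> g d1) d2 = gract \<tau> g (gcomp H d1 d2)"
    and glact_comp_right:
      "\<And>g d1 d2. \<lbrakk>g \<in> arrows G; d1 \<in> arrows H; d2 \<in> arrows H;
          tgt G g = src H d1; tgt H d1 = src H d2\<rbrakk> \<Longrightarrow>
        glact \<tau> g (gcomp H d1 d2) =
          gcomp H (glact \<tau> g d1) (glact \<tau> (gract \<tau> g d1) d2)"

text \<open>The map $\hat\sigma$ associated with \<open>\<sigma>\<close>. On the fibre product \<open>l' = phi G l a\<close>,
  so the formula does not use \<open>l'\<close>.\<close>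

definition sigma_hat ::
  "('l, 'h, 'n) dyn_group_scheme \<Rightarrow> ('l \<Rightarrow> 'g \<times> 'h \<Rightarrow> 'h \<times> 'g) \<Rightarrow>
     ('l \<times> 'g) \<times> ('l \<times> 'h) \<Rightarrow> ('l \<times> 'h) \<times> ('l \<times> 'g)"
  where
  "sigma_hat H \<sigma> =
     (\<lambda>((l, a), (l', x)). ((l, lact \<sigma> l a x), (phi H l (lact \<sigma> l a x), ract \<sigma> l a x)))"

end

theory Submission
  imports Defs
begin

text \<open>Every groupoid axiom is the \<open>\<Lambda>\<close>-indexed axiom of the same shape together with a
  statement about sources and targets, and these follow from \<open>\<sigma>\<close> being a morphism. The one
  exception is \<open>\<gamma> \<leftharpoonup> \<iota> = \<gamma>\<close>: axiom (4) only gives equality of the second components, and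
  one still has to see that \<open>a \<rightharpoonup>\<^sub>l e\<close> is a loop at \<open>l\<close>. Let \<open>l'\<close> be its target. Axiom (3)
  and cancellation give that \<open>a\<close> based at \<open>l'\<close> fixes \<open>e\<close>, hence so does its inverse \<open>b\<close>. Expanding
  \<open>(a \<circ>\<^sub>l b) \<leftharpoonup>\<^sub>l e\<close> by (6) now gives \<open>a \<circ>\<^bsub>l'\<^esub> b = e\<close>, while (4) gives \<open>a \<circ>\<^sub>l b\<close>. So
  \<open>a \<circ>\<^sub>l b = e\<close>, an arrow from \<open>l\<close> to \<open>l'\<close>, and therefore \<open>l = l'\<close>.\<close>

context dynamical_group
begin

lemma phi_right_inverse:
  assumes "l \<in> \<Lambda>" "a \<in> carr G" "b \<in> carr G" "dmul G l a b = dunit G"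
  shows "phi G (phi G l a) b = l"
  using phi_dmul[OF assms(1-3)] phi_dunit[OF assms(1)] assms(4) by simp

text \<open>Multiply on the left by an inverse of \<open>a\<close>, based at
  \<open>phi G l a\<close>: it leads back to \<open>l\<close>, which is what associativity
  requires.\<close>

lemma dmul_left_cancel:
  assumes l: "l \<in> \<Lambda>" and a: "a \<in> carr G" and b: "b \<in> carr G" and c: "c \<in> carr G"
    and eq: "dmul G l a b = dmul G l a c"
  shows "b = c"
proof -
  obtain i where i: "i \<in> carr G" "dmul G l a i = dunit G" "dmul G (phi G l a) i a = dunit G"
    using dinv_exists[OF l a] by blast
  have m: "phi G l a \<in> \<Lambda>" using l a by (rule phi_closed)
  have mi: "phi G (phi G l a) i = l" using phi_right_inverse[OF l a i(1,2)] .
  have "d = dmul G (phi G l a) i (dmul G l a d)" if "d \<in> carr G" for d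
    using dmul_assoc[OF m i(1) a that] by (simp add: mi i(3) dmul_dunit_left m that)
  then show ?thesis using b c eq by metis
qed

text \<open>Left cancellation makes the inverse unique, so the definite description in
  \<open>dinv\<close> is proper.\<close>

lemma dinv:
  assumes l: "l \<in> \<Lambda>" and a: "a \<in> carr G"
  shows dinv_closed: "dinv G l a \<in> carr G"
    and dmul_dinv_right: "dmul G l a (dinv G l a) = dunit G"
    and dmul_dinv_left: "dmul G (phi G l a) (dinv G l a) a = dunit G"
proof -
  have "\<exists>!b. b \<in> carr G \<and> dmul G l a b = dunit G \<and> dmul G (phi G l a) b a = dunit G"
    using dinv_exists[OF l a] dmul_left_cancel[OF l a] by (metis (no_types))
  from theI'[OF this, folded dinv_def]
  show "dinv G l a \<in> carr G" "dmul G l a (dinv G l a) = dunit G"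
    "dmul G (phi G l a) (dinv G l a) a = dunit G" by auto
qed

lemma phi_dinv:
  assumes "l \<in> \<Lambda>" "a \<in> carr G"
  shows "phi G (phi G l a) (dinv G l a) = l"
  using assms by (intro phi_right_inverse dinv_closed dmul_dinv_right)

lemma groupoid_dyn_groupoid: "groupoid (dyn_groupoid \<Lambda> G)"
  by unfold_locales
    (auto simp: dyn_groupoid_def phi_closed dmul_closed phi_dmul dmul_assoc dunit_closed
      dmul_dunit_right dmul_dunit_left phi_dunit dinv_closed dmul_dinv_right dmul_dinv_left
      phi_dinv)

end

context matched_pair_dynamical_groups
begin

lemma
  assumes "l \<in> \<Lambda>" "a \<in> carr G" "x \<in> carr H"
  shows lact_closed: "lact \<sigma> l a x \<in> carr H"
    and ract_closed: "ract \<sigma> l a x \<in> carr G"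
    and phi_lact_ract:
      "phi G (phi H l (lact \<sigma> l a x)) (ract \<sigma> l a x) = phi H (phi G l a) x"
proof -
  have "\<sigma> l (a, x) \<in> carr (dyn_tensor H G) \<and>
      phi (dyn_tensor H G) l (\<sigma> l (a, x)) = phi (dyn_tensor G H) l (a, x)"
    using sigma_morphism assms by (simp add: dyn_morphism_def dyn_tensor_def)
  then show "lact \<sigma> l a x \<in> carr H" "ract \<sigma> l a x \<in> carr G"
    "phi G (phi H l (lact \<sigma> l a x)) (ract \<sigma> l a x) = phi H (phi G l a) x"
    by (auto simp: dyn_tensor_def lact_def ract_def split: prod.splits)
qed

lemma phi_lact_dunit:
  assumes l: "l \<in> \<Lambda>" and a: "a \<in> carr G"
  shows "phi H l (lact \<sigma> l a (dunit H)) = l"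
proof -
  define l' where "l' = phi H l (lact \<sigma> l a (dunit H))"
  define m where "m = phi G l a"
  have eH: "dunit H \<in> carr H" by (rule H.dunit_closed)
  have u: "lact \<sigma> l a (dunit H) \<in> carr H" using l a eH by (rule lact_closed)
  have l': "l' \<in> \<Lambda>" unfolding l'_def using l u by (rule H.phi_closed)
  have m: "m \<in> \<Lambda>" unfolding m_def using l a by (rule G.phi_closed)
  have m': "phi G l' a = m"
    using phi_lact_ract[OF l a eH] by (simp add: l'_def m_def ract_dunit l a H.phi_dunit m[unfolded m_def])
  \<comment> \<open>The inverse is taken at \<open>l'\<close>, not at \<open>l\<close>. Since
    \<open>a\<close> has target \<open>m\<close> from both, \<open>b\<close> can also be composed
    after \<open>a\<close> at \<open>l\<close>.\<close>
  define b where "b = dinv G l' a"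
  have b: "b \<in> carr G" unfolding b_def using l' a by (rule G.dinv_closed)
  have ab: "dmul G l' a b = dunit G" unfolding b_def using l' a by (rule G.dmul_dinv_right)
  have ba: "dmul G m b a = dunit G" unfolding b_def m'[symmetric] using l' a by (rule G.dmul_dinv_left)
  have bl: "phi G m b = l'" unfolding b_def m'[symmetric] using l' a by (rule G.phi_dinv)
  have "dmul H l (lact \<sigma> l a (dunit H)) (lact \<sigma> l' a (dunit H)) = lact \<sigma> l a (dunit H)"
    using lact_dmul_right[OF l a eH eH]
    by (simp add: H.dmul_dunit_right m[unfolded m_def] eH ract_dunit l a l'_def)
  then have "lact \<sigma> l' a (dunit H) = dunit H"
    using H.dmul_left_cancel[OF l u lact_closed[OF l' a eH] eH] H.dmul_dunit_right[OF l u] by simp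
  \<comment> \<open>At \<open>m\<close>, \<open>b\<close> followed by \<open>a\<close> is the unit,
    and \<open>a\<close> at \<open>l'\<close> already fixes \<open>dunit H\<close>.\<close>
  then have fix_b: "lact \<sigma> m b (dunit H) = dunit H"
    using lact_dmul_left[OF m b a eH] lact_dunit[OF m eH] by (simp add: ba bl)
  have "dmul G l a b = ract \<sigma> l (dmul G l a b) (dunit H)"
    using l a b by (simp add: ract_dunit G.dmul_closed)
  \<comment> \<open>As \<open>b\<close> fixes \<open>dunit H\<close>, the product acts on it as
    \<open>a\<close> does, which moves the base point to \<open>l'\<close>.\<close>
  also have "\<dots> = dmul G l' a b"
    using ract_dmul_left[OF l a b eH] lact_dmul_left[OF l a b eH]
    by (simp flip: m_def l'_def add: fix_b ract_dunit l a b m)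
  finally have "phi G l (dmul G l a b) = l" using l by (simp add: ab G.phi_dunit)
  then show ?thesis using G.phi_dmul[OF l a b] by (simp add: bl l'_def flip: m_def)
qed

lemma matched_pair_dyn_groupoids:
  "matched_pair_groupoids (dyn_groupoid \<Lambda> G) (dyn_groupoid \<Lambda> H) (sigma_hat H \<sigma>)"
proof (rule matched_pair_groupoids.intro[OF G.groupoid_dyn_groupoid H.groupoid_dyn_groupoid],
    unfold_locales)
qed (auto simp: dyn_groupoid_def sigma_hat_def glact_def gract_def fibre_product_def
      G.phi_closed H.phi_closed lact_closed ract_closed phi_lact_ract phi_lact_dunit
      G.phi_dmul H.phi_dmul lact_dunit G.phi_dunit lact_dmul_left ract_dmul_left
      ract_dunit ract_dmul_right lact_dmul_right)

end

theorem proposition2p32: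
  fixes \<Lambda> :: "'l set"
    and G :: "('l, 'g) dyn_group"
    and H :: "('l, 'h) dyn_group"
    and \<sigma> :: "'l \<Rightarrow> 'g \<times> 'h \<Rightarrow> 'h \<times> 'g"
  assumes "matched_pair_dynamical_groups \<Lambda> G H \<sigma>"
  shows "matched_pair_groupoids (dyn_groupoid \<Lambda> G) (dyn_groupoid \<Lambda> H) (sigma_hat H \<sigma>)"
  using assms by (rule matched_pair_dynamical_groups.matched_pair_dyn_groupoids)

end
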